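(* We have $$A^{(3)}(x_1,x_2,x_3,\dots)=1+\frac{x_1^2x_2A^{(3)}(x_1,x_2x_3,x_3x_4,\dots)}{1-x_1^2x_2A^{(3)}(x_1,x_2x_3^2x_4,x_3x_4^2x_5,\dots)},$$ and $$B^{(3)}(x_1,x_2,x_3,\dots)=x_1A^{(3)}(x_1,x_2x_3,x_3x_4\dots).$$
   Context: A permutation $\pi$ is a Dumont permutation (of the first kind) if each even integer in $\pi$ is followed by a smaller integer, and each odd integer is either followed by a larger integer or is the last element of $\pi$. Let $\mathcal{D}$ be the set of Dumont permutations of all sizes (including the empty one) avoiding $1\mbox{-}3\mbox{-}2$. Generalized patterns: letters separated by dashes may be at any distance, adjacent letters (as $21$ in $21\mbox{-}3\mbox{-}\cdots\mbox{-}j$) must be adjacent in $\pi$. For a pattern $\tau$, $\tau(\pi)$ is its number of occurrences; $1(\pi)$ is the length of $\pi$. Define $\mathcal{C}(x_1,x_2,\dots)=\sum_{\pi\in\mathcal{D}}x_1^{1(\pi)}\prod_{j\geq2}x_j^{21\mbox{-}3\mbox{-}\dots\mbox{-} j(\pi)}$, $A^{(3)}=\frac12(\mathcal{C}(x_1,x_2,\dots)+\mathcal{C}(-x_1,x_2,\dots))$, $B^{(3)}=\frac12(\mathcal{C}(x_1,x_2,\dots)-\mathcal{C}(-x_1,x_2,\dots))$. *)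

theory Defs
  imports
    "HOL-Computational_Algebra.Formal_Power_Series"
    "HOL-Combinatorics.Multiset_Permutations"
begin

text \<open>
  Permutations of size \<open>n\<close> are written in one-line notation, as the elements of
  \<^term>\<open>permutations_of_set {1..n::nat}\<close>.
\<close>

definition dumont :: "nat list \<Rightarrow> bool" where
  "dumont \<pi> \<longleftrightarrow>
     (\<forall>i<length \<pi>.
        (even (\<pi> ! i) \<longrightarrow> Suc i < length \<pi> \<and> \<pi> ! Suc i < \<pi> ! i) \<and>
        (odd (\<pi> ! i) \<longrightarrow> Suc i = length \<pi> \<or> \<pi> ! i < \<pi> ! Suc i))"

text \<open>
  A generalized pattern is the list of its dash-free blocks, e.g. \<open>1-3-2\<close> is
  \<open>[[1], [3], [2]]\<close> and \<open>21-3\<close> is \<open>[[2, 1], [3]]\<close>.  An occurrence is recorded as the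
  increasing list of the positions it occupies; the list \<open>ss\<close> below holds the position
  at which each block starts, so that the letters of one block are adjacent.
\<close>

definition occurrences :: "nat list list \<Rightarrow> nat list \<Rightarrow> nat list set" where
  "occurrences \<tau> \<pi> =
     {ps. (\<exists>ss. length ss = length \<tau> \<and>
                ps = concat (map2 (\<lambda>s b. [s..<s + length b]) ss \<tau>)) \<and>
          sorted_wrt (<) ps \<and>
          set ps \<subseteq> {..<length \<pi>} \<and>
          (\<forall>a<length ps. \<forall>b<length ps.
             \<pi> ! (ps ! a) < \<pi> ! (ps ! b) \<longleftrightarrow> concat \<tau> ! a < concat \<tau> ! b)}"

definition occ :: "nat list list \<Rightarrow> nat list \<Rightarrow> nat" where
  "occ \<tau> \<pi> = card (occurrences \<tau> \<pi>)"

definition avoids :: "nat list \<Rightarrow> nat list list \<Rightarrow> bool" where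
  "avoids \<pi> \<tau> \<longleftrightarrow> occurrences \<tau> \<pi> = {}"

text \<open>The pattern \<open>21-3-\<dots>-j\<close>, for \<open>j \<ge> 2\<close>.\<close>

definition pat21 :: "nat \<Rightarrow> nat list list" where
  "pat21 j = [2, 1] # map (\<lambda>k. [k]) [3..<Suc j]"

definition dumont_avoid_132 :: "nat list set" where
  "dumont_avoid_132 =
     {\<pi>. (\<exists>n. \<pi> \<in> permutations_of_set {1..n}) \<and> dumont \<pi> \<and> avoids \<pi> [[1], [3], [2]]}"

text \<open>
  Generating functions are formal power series in \<open>x\<^sub>1\<close> (the indeterminate \<^term>\<open>fps_X\<close>);
  \<open>x\<^sub>2, x\<^sub>3, \<dots>\<close> are given by a sequence \<open>x\<close> of elements of a field of characteristic \<open>0\<close>,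
  and \<open>x 0\<close>, \<open>x 1\<close> are not used.  Since the field and the sequence are arbitrary, the
  \<open>x\<^sub>j\<close> may be taken to be the independent indeterminates of the field of fractions of
  the polynomial ring over the rationals in \<open>x\<^sub>2, x\<^sub>3, \<dots>\<close>.  The product over all
  \<open>j \<ge> 2\<close> stops at \<open>j = length \<pi>\<close>, because the longer patterns do not occur in \<open>\<pi>\<close>
  and contribute the factor \<open>1\<close>.
\<close>

definition C_gf :: "(nat \<Rightarrow> 'a::field_char_0) \<Rightarrow> 'a fps" where
  "C_gf x = Abs_fps (\<lambda>n. \<Sum>\<pi> | \<pi> \<in> dumont_avoid_132 \<and> length \<pi> = n.
                          \<Prod>j=2..length \<pi>. x j ^ occ (pat21 j) \<pi>)"

text \<open>Composition with \<^term>\<open>- fps_X\<close> is the substitution of \<open>-x\<^sub>1\<close> for \<open>x\<^sub>1\<close>.\<close>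

definition A3 :: "(nat \<Rightarrow> 'a::field_char_0) \<Rightarrow> 'a fps" where
  "A3 x = fps_const (1/2) * (C_gf x + (C_gf x oo (- fps_X)))"

definition B3 :: "(nat \<Rightarrow> 'a::field_char_0) \<Rightarrow> 'a fps" where
  "B3 x = fps_const (1/2) * (C_gf x - (C_gf x oo (- fps_X)))"

end

theory Submission
  imports Defs
begin

unbundle fps_syntax

text \<open>
  A nonempty permutation avoiding \<open>1-3-2\<close> is, in a unique way, a shifted permutation \<open>\<sigma>\<close>, the
  greatest letter \<open>m\<close> and a permutation \<open>\<rho>\<close>, where the letters before \<open>m\<close> are greater than those
  after it. It is a Dumont permutation iff \<open>\<sigma>\<close> (shifted) and \<open>\<rho>\<close> are and \<open>m\<close> is odd exactly when
  \<open>\<rho>\<close> is empty. A shift by an odd number makes the least letter of a nonempty \<open>\<sigma>\<close> even, and no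
  smaller letter can follow it; so \<open>\<sigma>\<close> is empty or \<open>\<rho>\<close> has even size. Hence the objects of odd size
  are the \<open>\<sigma> m\<close> with \<open>\<sigma>\<close> of even size, and the nonempty objects of even size are the \<open>m \<rho>\<close> with
  \<open>\<rho>\<close> of odd size and the \<open>\<sigma> m \<rho>\<close> with \<open>\<sigma>\<close> of odd size and \<open>\<rho>\<close> nonempty of even size.

  An occurrence of a pattern in \<open>(\<sigma> m) \<rho>\<close> that meets both parts has its first letter above its last,
  so among the patterns \<open>21-3-\<dots>-j\<close> only \<open>21\<close> has one, at the descent from \<open>m\<close>. An occurrence
  in \<open>\<sigma> m\<close> of \<open>21-3-\<dots>-(j + 1)\<close> that uses \<open>m\<close> is one of \<open>21-3-\<dots>-j\<close> in \<open>\<sigma>\<close>, so appending \<open>m\<close>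
  replaces \<open>x\<^sub>j\<close> by \<open>x\<^sub>j x\<^sub>j\<^sub>+\<^sub>1\<close> in the weight.
\<close>

section \<open>Generating functions of combinatorial classes\<close>

definition size_finite :: "('b \<Rightarrow> nat) \<Rightarrow> 'b set \<Rightarrow> bool" where
  "size_finite sz S \<longleftrightarrow> (\<forall>n. finite {s \<in> S. sz s = n})"

lemma size_finiteD: "size_finite sz S \<Longrightarrow> finite {s \<in> S. sz s = n}"
  by (simp add: size_finite_def)

lemma size_finite_subset: "size_finite sz T \<Longrightarrow> S \<subseteq> T \<Longrightarrow> size_finite sz S"
  unfolding size_finite_def by (blast intro: finite_subset[rotated])

definition class_gf :: "('b \<Rightarrow> nat) \<Rightarrow> ('b \<Rightarrow> 'a::comm_semiring_1) \<Rightarrow> 'b set \<Rightarrow> 'a fps" where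
  "class_gf sz w S = Abs_fps (\<lambda>n. \<Sum>s | s \<in> S \<and> sz s = n. w s)"

lemma class_gf_cong:
  assumes "\<And>s. s \<in> S \<Longrightarrow> sz s = sz' s" "\<And>s. s \<in> S \<Longrightarrow> w s = w' s"
  shows "class_gf sz w S = class_gf sz' w' S"
  unfolding class_gf_def by (intro fps_ext) (auto intro!: sum.cong simp: assms)

lemma class_gf_image:
  assumes "inj_on h S"
  shows "class_gf sz w (h ` S) = class_gf (\<lambda>s. sz (h s)) (\<lambda>s. w (h s)) S"
proof (rule fps_ext)
  fix n
  have "{t \<in> h ` S. sz t = n} = h ` {s \<in> S. sz (h s) = n}" by auto
  moreover have "inj_on h {s \<in> S. sz (h s) = n}" using assms by (rule inj_on_subset) auto
  ultimately show "class_gf sz w (h ` S) $ n = class_gf (\<lambda>s. sz (h s)) (\<lambda>s. w (h s)) S $ n"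
    by (simp add: class_gf_def sum.reindex)
qed

lemma class_gf_Un:
  assumes "size_finite sz S" "size_finite sz T" "S \<inter> T = {}"
  shows "class_gf sz w (S \<union> T) = class_gf sz w S + class_gf sz w T"
proof (rule fps_ext)
  fix n
  have "{s \<in> S \<union> T. sz s = n} = {s \<in> S. sz s = n} \<union> {t \<in> T. sz t = n}" by auto
  moreover have "{s \<in> S. sz s = n} \<inter> {t \<in> T. sz t = n} = {}" using assms(3) by auto
  ultimately show "class_gf sz w (S \<union> T) $ n = (class_gf sz w S + class_gf sz w T) $ n"
    using assms(1,2) by (simp add: class_gf_def size_finiteD sum.union_disjoint)
qed

lemma Times_total_size_eq:
  fixes sz :: "'b \<Rightarrow> nat" and sz' :: "'c \<Rightarrow> nat"
  shows "{p \<in> S \<times> T. (case p of (s, t) \<Rightarrow> sz s + sz' t) = n} =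
    (\<Union>i\<in>{0..n}. {s \<in> S. sz s = i} \<times> {t \<in> T. sz' t = n - i})"
  by auto

lemma size_finite_Times:
  assumes "size_finite sz S" "size_finite sz' T"
  shows "size_finite (\<lambda>(s, t). sz s + sz' t) (S \<times> T)"
  unfolding size_finite_def Times_total_size_eq using assms
  by (intro allI finite_UN_I finite_cartesian_product size_finiteD finite_atLeastAtMost)

lemma class_gf_Times:
  assumes "size_finite sz S" "size_finite sz' T"
  shows "class_gf (\<lambda>(s, t). sz s + sz' t) (\<lambda>(s, t). w s * w' t) (S \<times> T) =
    class_gf sz w S * class_gf sz' w' T"
proof (rule fps_ext)
  fix n
  let ?S = "\<lambda>i. {s \<in> S. sz s = i}" and ?T = "\<lambda>i. {t \<in> T. sz' t = i}"
  let ?w = "\<lambda>(s, t). w s * w' t"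
  have "class_gf (\<lambda>(s, t). sz s + sz' t) ?w (S \<times> T) $ n =
      sum ?w (\<Union>i\<in>{0..n}. ?S i \<times> ?T (n - i))"
    by (simp only: class_gf_def fps_nth_Abs_fps Times_total_size_eq)
  also have "\<dots> = (\<Sum>i=0..n. sum ?w (?S i \<times> ?T (n - i)))"
    using assms by (intro sum.UNION_disjoint) (auto simp: size_finiteD)
  also have "\<dots> = (\<Sum>i=0..n. (\<Sum>s\<in>?S i. w s) * (\<Sum>t\<in>?T (n - i). w' t))"
    by (simp add: sum_product sum.cartesian_product)
  finally show "class_gf (\<lambda>(s, t). sz s + sz' t) ?w (S \<times> T) $ n =
      (class_gf sz w S * class_gf sz' w' T) $ n"
    by (simp add: fps_mult_nth class_gf_def)
qed

lemma class_gf_Suc: "class_gf (\<lambda>s. Suc (sz s)) w S = fps_X * class_gf sz w S"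
proof (rule fps_ext)
  show "class_gf (\<lambda>s. Suc (sz s)) w S $ n = (fps_X * class_gf sz w S) $ n" for n
    by (cases n) (simp_all add: class_gf_def)
qed

lemma class_gf_mult_const: "class_gf sz (\<lambda>s. c * w s) S = fps_const c * class_gf sz w S"
  by (rule fps_ext) (simp add: class_gf_def sum_distrib_left)

lemma class_gf_singleton: "class_gf sz w {s} = fps_const (w s) * fps_X ^ sz s"
proof (rule fps_ext)
  fix n
  have "{t. t = s \<and> sz t = n} = (if n = sz s then {s} else {})" by auto
  then show "class_gf sz w {s} $ n = (fps_const (w s) * fps_X ^ sz s) $ n"
    by (simp add: class_gf_def fps_X_power_nth)
qed

lemma class_gf_filter_size_nth:
  "class_gf sz w {s \<in> S. P (sz s)} $ n = (if P n then class_gf sz w S $ n else 0)"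
proof -
  have "{s. (s \<in> S \<and> P (sz s)) \<and> sz s = n} = (if P n then {s. s \<in> S \<and> sz s = n} else {})"
    by auto
  then show ?thesis by (simp add: class_gf_def)
qed

lemma fps_compose_uminus_fps_X_nth:
  fixes f :: "'a::comm_ring_1 fps"
  shows "(f oo - fps_X) $ n = (- 1) ^ n * f $ n"
proof -
  have "- fps_X = fps_const (- 1) * (fps_X :: 'a fps)" by (simp flip: fps_const_neg)
  then show ?thesis by (simp only: fps_compose_linear fps_nth_Abs_fps)
qed

section \<open>Occurrences of generalized patterns\<close>

primrec placements :: "nat list list \<Rightarrow> nat list set" where
  "placements [] = {[]}"
| "placements (b # \<tau>) = {[s..<s + length b] @ qs |s qs. qs \<in> placements \<tau>}"

lemma placements_eq:
  "placements \<tau> = {concat (map2 (\<lambda>s b. [s..<s + length b]) ss \<tau>) |ss. length ss = length \<tau>}"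
proof (induction \<tau>)
  case (Cons b \<tau>)
  let ?f = "\<lambda>s b. [s..<s + length b]"
  have "{concat (map2 ?f ss (b # \<tau>)) |ss. length ss = length (b # \<tau>)} =
      {?f s b @ concat (map2 ?f ss \<tau>) |s ss. length ss = length \<tau>}" (is "?L = ?R")
  proof
    show "?L \<subseteq> ?R" by (auto simp: length_Suc_conv)
    show "?R \<subseteq> ?L"
    proof clarify
      fix s and ss :: "nat list" assume "length ss = length \<tau>"
      then show "\<exists>ss'. ?f s b @ concat (map2 ?f ss \<tau>) = concat (map2 ?f ss' (b # \<tau>)) \<and>
          length ss' = length (b # \<tau>)"
        by (intro exI[of _ "s # ss"]) simp
    qed
  qed
  then show ?case by (auto simp: Cons.IH)
qed simp

lemma mem_placements_snoc_singleton_iff: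
  "ps \<in> placements (\<tau> @ [[v]]) \<longleftrightarrow> (\<exists>qs p. qs \<in> placements \<tau> \<and> ps = qs @ [p])"
proof (induction \<tau> arbitrary: ps)
  case (Cons b \<tau>)
  show ?case by (simp add: Cons.IH) (metis append_assoc)
qed simp

lemma length_placements: "ps \<in> placements \<tau> \<Longrightarrow> length ps = length (concat \<tau>)"
  by (induction \<tau> arbitrary: ps) auto

lemma map_upt_commute_Suc:
  assumes "\<And>p. s \<le> p \<Longrightarrow> p < s + n \<Longrightarrow> f (Suc p) = Suc (f p)"
  shows "map f [s..<s + n] = [f s..<f s + n]"
proof -
  have "f (s + i) = f s + i" if "i \<le> n" for i
    using that assms by (induction i) auto
  then show ?thesis by (auto intro: nth_equalityI)
qed

lemma map_mem_placements:
  assumes "ps \<in> placements \<tau>" "\<And>p. p \<in> set ps \<Longrightarrow> f (Suc p) = Suc (f p)"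
  shows "map f ps \<in> placements \<tau>"
  using assms
proof (induction \<tau> arbitrary: ps)
  case (Cons b \<tau>)
  then obtain s qs where qs: "qs \<in> placements \<tau>" and ps: "ps = [s..<s + length b] @ qs"
    by auto
  have "map f [s..<s + length b] = [f s..<f s + length b]"
    using Cons.prems(2) by (intro map_upt_commute_Suc) (simp add: ps)
  moreover have "map f qs \<in> placements \<tau>"
    using Cons.IH[OF qs] Cons.prems(2) by (simp add: ps)
  ultimately show ?case by (auto simp: ps)
qed simp

lemma map_add_mem_placements_iff: "map ((+) n) ps \<in> placements \<tau> \<longleftrightarrow> ps \<in> placements \<tau>"
proof
  assume "map ((+) n) ps \<in> placements \<tau>"
  then have "map (\<lambda>p. p - n) (map ((+) n) ps) \<in> placements \<tau>"
    by (rule map_mem_placements) auto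
  then show "ps \<in> placements \<tau>" by (simp add: comp_def)
qed (simp add: map_mem_placements)

definition order_iso :: "'a::linorder list \<Rightarrow> 'b::linorder list \<Rightarrow> bool" where
  "order_iso us vs \<longleftrightarrow> length us = length vs \<and>
     (\<forall>i<length us. \<forall>j<length us. us ! i < us ! j \<longleftrightarrow> vs ! i < vs ! j)"

lemma order_iso_map_strict_mono:
  "strict_mono f \<Longrightarrow> order_iso (map f us) vs \<longleftrightarrow> order_iso us vs"
  by (simp add: order_iso_def strict_mono_less)

lemma order_iso_snoc_greatest:
  assumes "\<forall>y\<in>set us. y < u" "\<forall>z\<in>set vs. z < v"
  shows "order_iso (us @ [u]) (vs @ [v]) \<longleftrightarrow> order_iso us vs"
proof (cases "length us = length vs")
  case True
  let ?us = "us @ [u]" and ?vs = "vs @ [v]" and ?n = "length us"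
  have us: "?us ! i < u" "\<not> u < ?us ! i" and vs: "?vs ! i < v" "\<not> v < ?vs ! i" if "i < ?n" for i
    using that assms True by (auto simp: nth_append intro: less_asym)
  have "?us ! ?n = u" "?vs ! ?n = v" using True by (auto simp: nth_append)
  then have "order_iso ?us ?vs \<longleftrightarrow>
      (\<forall>i<?n. \<forall>j<?n. ?us ! i < ?us ! j \<longleftrightarrow> ?vs ! i < ?vs ! j)"
    using True us vs by (auto simp: order_iso_def All_less_Suc)
  also have "\<dots> \<longleftrightarrow> order_iso us vs"
    using True by (auto simp: order_iso_def nth_append)
  finally show ?thesis .
qed (simp add: order_iso_def)

lemma order_iso_last_less_hd:
  assumes "order_iso us vs" "last us < hd us" "us \<noteq> []"
  shows "last vs < hd vs"
proof -
  have "vs \<noteq> []" "length us = length vs" using assms by (auto simp: order_iso_def)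
  then show ?thesis
    using assms by (simp add: order_iso_def last_conv_nth hd_conv_nth)
qed

lemma order_iso_last_greatest:
  assumes "order_iso us vs" "\<forall>u\<in>set us. u \<le> last us" "us \<noteq> []"
  shows "\<forall>v\<in>set vs. v \<le> last vs"
proof -
  have "vs \<noteq> []" and len: "length us = length vs" using assms by (auto simp: order_iso_def)
  have "vs ! i \<le> last vs" if "i < length vs" for i
  proof -
    have "\<not> last us < us ! i" using assms(2) that len by (simp add: not_less)
    then have "\<not> last vs < vs ! i"
      using assms(1,3) \<open>vs \<noteq> []\<close> that len by (simp add: order_iso_def last_conv_nth)
    then show ?thesis by simp
  qed
  then show ?thesis by (simp add: all_set_conv_all_nth)
qed

lemma mem_occurrences_iff:
  "ps \<in> occurrences \<tau> \<pi> \<longleftrightarrow> ps \<in> placements \<tau> \<and> sorted_wrt (<) ps \<and>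
     set ps \<subseteq> {..<length \<pi>} \<and> order_iso (map (nth \<pi>) ps) (concat \<tau>)"
proof -
  have "ps \<in> occurrences \<tau> \<pi> \<longleftrightarrow> ps \<in> placements \<tau> \<and> sorted_wrt (<) ps \<and>
      set ps \<subseteq> {..<length \<pi>} \<and>
      (\<forall>a<length ps. \<forall>b<length ps.
         \<pi> ! (ps ! a) < \<pi> ! (ps ! b) \<longleftrightarrow> concat \<tau> ! a < concat \<tau> ! b)"
    by (auto simp: occurrences_def placements_eq)
  then show ?thesis by (auto simp: order_iso_def length_placements)
qed

lemma length_occurrences: "ps \<in> occurrences \<tau> \<pi> \<Longrightarrow> length ps = length (concat \<tau>)"
  by (simp add: mem_occurrences_iff length_placements)

lemma finite_occurrences: "finite (occurrences \<tau> \<pi>)"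
proof (rule finite_subset)
  show "occurrences \<tau> \<pi> \<subseteq> {ps. set ps \<subseteq> {..<length \<pi>} \<and> length ps = length (concat \<tau>)}"
    by (auto simp: mem_occurrences_iff length_placements)
qed (simp add: finite_lists_length_eq)

lemma avoids_iff_occ_eq_0: "avoids \<pi> \<tau> \<longleftrightarrow> occ \<tau> \<pi> = 0"
  by (simp add: avoids_def occ_def finite_occurrences)

lemma occ_map_strict_mono:
  assumes "strict_mono f"
  shows "occ \<tau> (map f \<pi>) = occ \<tau> \<pi>"
proof -
  have "map (nth (map f \<pi>)) ps = map f (map (nth \<pi>) ps)" if "set ps \<subseteq> {..<length \<pi>}" for ps
    using that by auto
  then have "occurrences \<tau> (map f \<pi>) = occurrences \<tau> \<pi>"
    by (auto simp: mem_occurrences_iff order_iso_map_strict_mono[OF assms] simp del: map_map)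
  then show ?thesis by (simp add: occ_def)
qed

lemma occ_eq_0_if_shorter:
  assumes "length \<pi> < length (concat \<tau>)"
  shows "occ \<tau> \<pi> = 0"
proof -
  have "ps \<notin> occurrences \<tau> \<pi>" for ps
  proof
    assume ps: "ps \<in> occurrences \<tau> \<pi>"
    then have "distinct ps" "set ps \<subseteq> {..<length \<pi>}"
      by (auto simp: mem_occurrences_iff strict_sorted_iff)
    then have "length ps \<le> length \<pi>"
      by (metis card_lessThan card_mono distinct_card finite_lessThan)
    then show False using assms length_occurrences[OF ps] by simp
  qed
  then have "occurrences \<tau> \<pi> = {}" by blast
  then show ?thesis by (simp add: occ_def)
qed

definition straddling :: "nat list list \<Rightarrow> nat list \<Rightarrow> nat list \<Rightarrow> nat list set" where
  "straddling \<tau> \<sigma> \<rho> = {ps \<in> occurrences \<tau> (\<sigma> @ \<rho>).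
     \<not> set ps \<subseteq> {..<length \<sigma>} \<and> \<not> set ps \<subseteq> {length \<sigma>..}}"

lemma occurrences_append_left:
  "{ps \<in> occurrences \<tau> (\<sigma> @ \<rho>). set ps \<subseteq> {..<length \<sigma>}} = occurrences \<tau> \<sigma>"
proof -
  have "ps \<in> occurrences \<tau> (\<sigma> @ \<rho>) \<longleftrightarrow> ps \<in> occurrences \<tau> \<sigma>" if "set ps \<subseteq> {..<length \<sigma>}" for ps
  proof -
    have "map (nth (\<sigma> @ \<rho>)) ps = map (nth \<sigma>) ps" using that by (auto simp: nth_append)
    moreover have "set ps \<subseteq> {..<length (\<sigma> @ \<rho>)}" using that by auto
    ultimately show ?thesis using that by (metis mem_occurrences_iff)
  qed
  then show ?thesis using mem_occurrences_iff[of _ \<tau> \<sigma>] by blast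
qed

lemma occurrences_append_right:
  "{ps \<in> occurrences \<tau> (\<sigma> @ \<rho>). set ps \<subseteq> {length \<sigma>..}} =
     map ((+) (length \<sigma>)) ` occurrences \<tau> \<rho>"
proof -
  let ?f = "map ((+) (length \<sigma>))"
  have "map (nth (\<sigma> @ \<rho>)) (?f qs) = map (nth \<rho>) qs" for qs
    by (simp add: nth_append)
  then have shift: "?f qs \<in> occurrences \<tau> (\<sigma> @ \<rho>) \<longleftrightarrow> qs \<in> occurrences \<tau> \<rho>" for qs
    by (auto simp: mem_occurrences_iff map_add_mem_placements_iff sorted_wrt_map simp del: map_map)
  show ?thesis
  proof (intro equalityI subsetI)
    fix ps assume ps: "ps \<in> {ps \<in> occurrences \<tau> (\<sigma> @ \<rho>). set ps \<subseteq> {length \<sigma>..}}"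
    then have "ps = ?f (map (\<lambda>p. p - length \<sigma>) ps)"
      by (auto intro!: map_idI[symmetric])
    then show "ps \<in> ?f ` occurrences \<tau> \<rho>"
      using ps shift by (metis (no_types, lifting) image_eqI mem_Collect_eq)
  qed (use shift in auto)
qed

lemma occ_append:
  assumes "concat \<tau> \<noteq> []"
  shows "occ \<tau> (\<sigma> @ \<rho>) = occ \<tau> \<sigma> + occ \<tau> \<rho> + card (straddling \<tau> \<sigma> \<rho>)"
proof -
  let ?O = "occurrences \<tau> (\<sigma> @ \<rho>)" and ?n = "length \<sigma>"
  let ?L = "{ps \<in> ?O. set ps \<subseteq> {..<?n}}" and ?R = "{ps \<in> ?O. set ps \<subseteq> {?n..}}"
  have "ps \<noteq> []" if "ps \<in> ?O" for ps
    using assms length_occurrences[OF that] by auto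
  then have "?L \<inter> ?R = {}" "(?L \<union> ?R) \<inter> straddling \<tau> \<sigma> \<rho> = {}"
    by (auto simp: straddling_def subset_iff) (metis last_in_set not_le)
  moreover have "finite ?L" "finite ?R" "finite (straddling \<tau> \<sigma> \<rho>)"
    by (simp_all add: finite_occurrences straddling_def)
  ultimately have "card ((?L \<union> ?R) \<union> straddling \<tau> \<sigma> \<rho>) =
      card ?L + card ?R + card (straddling \<tau> \<sigma> \<rho>)"
    by (simp only: card_Un_disjoint finite_Un simp_thms)
  moreover have "(?L \<union> ?R) \<union> straddling \<tau> \<sigma> \<rho> = ?O"
    by (auto simp: straddling_def)
  moreover have "card ?R = occ \<tau> \<rho>"
    unfolding occurrences_append_right occ_def
    by (intro card_image) (simp add: inj_on_def inj_map_eq_map)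
  ultimately show ?thesis by (simp add: occ_def occurrences_append_left)
qed

lemma straddling_ends:
  assumes "ps \<in> straddling \<tau> \<sigma> \<rho>"
  shows "ps \<noteq> []" "hd ps < length \<sigma>" "length \<sigma> \<le> last ps" "last ps < length (\<sigma> @ \<rho>)"
proof -
  have ps: "sorted_wrt (<) ps" "set ps \<subseteq> {..<length (\<sigma> @ \<rho>)}"
    using assms by (auto simp: straddling_def mem_occurrences_iff)
  obtain p q where pq: "p \<in> set ps" "p < length \<sigma>" "q \<in> set ps" "length \<sigma> \<le> q"
    using assms by (auto simp: straddling_def subset_iff not_le not_less)
  show "ps \<noteq> []" using pq by auto
  have "hd ps \<le> p"
    using ps(1) pq(1) by (cases ps) auto
  then show "hd ps < length \<sigma>" using pq(2) by simp
  have "q \<le> last ps"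
    using ps(1) pq(3) by (cases ps rule: rev_cases) (auto simp: sorted_wrt_append)
  then show "length \<sigma> \<le> last ps" using pq(4) by simp
  show "last ps < length (\<sigma> @ \<rho>)" using ps(2) last_in_set[OF \<open>ps \<noteq> []\<close>] by auto
qed

definition above :: "'a::order list \<Rightarrow> 'a list \<Rightarrow> bool" where
  "above \<sigma> \<rho> \<longleftrightarrow> (\<forall>a\<in>set \<sigma>. \<forall>b\<in>set \<rho>. b < a)"

lemma straddling_above_eq_empty:
  assumes "above \<sigma> \<rho>" "hd (concat \<tau>) \<le> last (concat \<tau>)"
  shows "straddling \<tau> \<sigma> \<rho> = {}"
proof -
  have "ps \<notin> straddling \<tau> \<sigma> \<rho>" for ps
  proof
    assume ps: "ps \<in> straddling \<tau> \<sigma> \<rho>"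
    have "(\<sigma> @ \<rho>) ! hd ps \<in> set \<sigma>" "(\<sigma> @ \<rho>) ! last ps \<in> set \<rho>"
      using straddling_ends[OF ps] by (auto simp: nth_append)
    then have "last (map (nth (\<sigma> @ \<rho>)) ps) < hd (map (nth (\<sigma> @ \<rho>)) ps)"
      using assms(1) straddling_ends(1)[OF ps] by (simp add: above_def last_map hd_map)
    moreover have "order_iso (map (nth (\<sigma> @ \<rho>)) ps) (concat \<tau>)"
      using ps by (simp add: straddling_def mem_occurrences_iff)
    ultimately show False
      using assms(2) straddling_ends(1)[OF ps] by (auto dest: order_iso_last_less_hd)
  qed
  then show ?thesis by blast
qed

lemma straddling_snoc_eq_empty:
  assumes "above [m] \<pi>" "a \<in> set (concat \<tau>)" "last (concat \<tau>) < a"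
  shows "straddling \<tau> \<pi> [m] = {}"
proof -
  have "ps \<notin> straddling \<tau> \<pi> [m]" for ps
  proof
    assume ps: "ps \<in> straddling \<tau> \<pi> [m]"
    then have iso: "order_iso (map (nth (\<pi> @ [m])) ps) (concat \<tau>)"
      and "set ps \<subseteq> {..<length (\<pi> @ [m])}"
      by (auto simp: straddling_def mem_occurrences_iff)
    then have "\<forall>y\<in>set (map (nth (\<pi> @ [m])) ps). y \<le> m"
      using assms(1) by (auto simp: above_def nth_append subset_iff less_imp_le)
    moreover have "last (map (nth (\<pi> @ [m])) ps) = m"
      using straddling_ends[OF ps] by (simp add: last_map nth_append)
    ultimately show False
      using order_iso_last_greatest[OF iso] straddling_ends(1)[OF ps] assms(2,3) by force
  qed
  then show ?thesis by blast
qed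

lemma straddling_snoc:
  assumes "above [m] \<pi>" "\<forall>a\<in>set (concat \<tau>). a < v" "concat \<tau> \<noteq> []"
  shows "straddling (\<tau> @ [[v]]) \<pi> [m] = (\<lambda>qs. qs @ [length \<pi>]) ` occurrences \<tau> \<pi>"
proof -
  have occ_iff: "qs @ [length \<pi>] \<in> occurrences (\<tau> @ [[v]]) (\<pi> @ [m]) \<longleftrightarrow> qs \<in> occurrences \<tau> \<pi>"
    for qs
  proof (cases "set qs \<subseteq> {..<length \<pi>}")
    case True
    then have "map (nth (\<pi> @ [m])) qs = map (nth \<pi>) qs" "\<forall>y\<in>set (map (nth \<pi>) qs). y < m"
      using assms(1) by (auto simp: nth_append above_def)
    then have "order_iso (map (nth (\<pi> @ [m])) (qs @ [length \<pi>])) (concat (\<tau> @ [[v]])) \<longleftrightarrow>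
        order_iso (map (nth \<pi>) qs) (concat \<tau>)"
      using order_iso_snoc_greatest[OF _ assms(2), of "map (nth \<pi>) qs" m] by (simp del: map_eq_conv)
    then show ?thesis
      using True unfolding mem_occurrences_iff mem_placements_snoc_singleton_iff
      by (auto simp: sorted_wrt_append)
  qed (auto simp: mem_occurrences_iff sorted_wrt_append)
  show ?thesis
  proof (intro equalityI subsetI)
    fix ps assume ps: "ps \<in> straddling (\<tau> @ [[v]]) \<pi> [m]"
    then have "ps \<in> occurrences (\<tau> @ [[v]]) (\<pi> @ [m])" by (simp add: straddling_def)
    moreover from this obtain qs p where "ps = qs @ [p]"
      by (auto simp: mem_occurrences_iff mem_placements_snoc_singleton_iff)
    moreover from this have "p = length \<pi>" using straddling_ends[OF ps] by simp
    ultimately show "ps \<in> (\<lambda>qs. qs @ [length \<pi>]) ` occurrences \<tau> \<pi>" using occ_iff by auto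
  next
    fix ps assume "ps \<in> (\<lambda>qs. qs @ [length \<pi>]) ` occurrences \<tau> \<pi>"
    then obtain qs where qs: "qs \<in> occurrences \<tau> \<pi>" "ps = qs @ [length \<pi>]" by blast
    moreover have "qs \<noteq> []" using assms(3) length_occurrences[OF qs(1)] by auto
    moreover have "set qs \<subseteq> {..<length \<pi>}" using qs(1) by (simp add: mem_occurrences_iff)
    ultimately show "ps \<in> straddling (\<tau> @ [[v]]) \<pi> [m]"
      using occ_iff by (auto simp: straddling_def neq_Nil_conv)
  qed
qed

lemma straddling_21:
  assumes "above \<sigma> \<rho>" "\<sigma> \<noteq> []" "\<rho> \<noteq> []"
  shows "straddling [[2, 1]] \<sigma> \<rho> = {[length \<sigma> - 1, length \<sigma>]}"
proof (intro equalityI subsetI)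
  fix ps assume ps: "ps \<in> straddling [[2, 1]] \<sigma> \<rho>"
  then obtain s where "ps = [s, Suc s]"
    by (auto simp: straddling_def mem_occurrences_iff upt_rec)
  then show "ps \<in> {[length \<sigma> - 1, length \<sigma>]}"
    using straddling_ends[OF ps] by auto
next
  fix ps assume "ps \<in> {[length \<sigma> - 1, length \<sigma>]}"
  moreover obtain n where n: "length \<sigma> = Suc n"
    using assms(2) by (cases \<sigma>) auto
  ultimately have ps: "ps = [n, Suc n]" by simp
  have "(\<sigma> @ \<rho>) ! Suc n < (\<sigma> @ \<rho>) ! n"
    using assms(1,3) by (simp add: above_def nth_append n)
  then have "order_iso (map (nth (\<sigma> @ \<rho>)) ps) (concat [[2, 1::nat]])"
    by (auto simp: order_iso_def ps less_Suc_eq)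
  then show "ps \<in> straddling [[2, 1]] \<sigma> \<rho>"
    using assms(3) by (auto simp: straddling_def mem_occurrences_iff ps n upt_rec)
qed

lemma occ_snoc_not_greatest:
  assumes "above [m] \<pi>" "a \<in> set (concat \<tau>)" "last (concat \<tau>) < a"
  shows "occ \<tau> (\<pi> @ [m]) = occ \<tau> \<pi>"
proof -
  have "1 < length (concat \<tau>)"
    using assms(2,3) by (cases "concat \<tau>") auto
  then have "occ \<tau> [m] = 0" "concat \<tau> \<noteq> []"
    by (simp_all add: occ_eq_0_if_shorter flip: length_greater_0_conv del: concat_eq_Nil_conv)
  then show ?thesis
    by (simp add: occ_append straddling_snoc_eq_empty[OF assms])
qed

lemma occ_snoc_greatest:
  assumes "above [m] \<pi>" "\<forall>a\<in>set (concat \<tau>). a < v" "concat \<tau> \<noteq> []"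
  shows "occ (\<tau> @ [[v]]) (\<pi> @ [m]) = occ (\<tau> @ [[v]]) \<pi> + occ \<tau> \<pi>"
proof -
  have "occ (\<tau> @ [[v]]) [m] = 0"
    using assms(3) by (intro occ_eq_0_if_shorter) (simp del: concat_eq_Nil_conv add: neq_Nil_conv)
  moreover have "card (straddling (\<tau> @ [[v]]) \<pi> [m]) = occ \<tau> \<pi>"
    unfolding straddling_snoc[OF assms] occ_def by (intro card_image) (simp add: inj_on_def)
  ultimately show ?thesis by (simp add: occ_append)
qed


section \<open>Weights\<close>

lemma pat21_Suc: "2 \<le> j \<Longrightarrow> pat21 (Suc j) = pat21 j @ [[Suc j]]"
  by (simp add: pat21_def)

lemma pat21_2: "pat21 2 = [[2, 1]]"
  by (simp add: pat21_def)

lemma concat_pat21: "concat (pat21 j) = [2, 1] @ [3..<Suc j]"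
  by (simp add: pat21_def)

lemma occ_pat21_eq_0: "length \<pi> < j \<Longrightarrow> occ (pat21 j) \<pi> = 0"
  by (rule occ_eq_0_if_shorter) (simp only: concat_pat21, auto)

lemma occ_pat21_snoc:
  assumes "above [m] \<pi>" "2 \<le> j"
  shows "occ (pat21 (Suc j)) (\<pi> @ [m]) = occ (pat21 (Suc j)) \<pi> + occ (pat21 j) \<pi>"
  unfolding pat21_Suc[OF assms(2)] using assms
  by (intro occ_snoc_greatest) (auto simp: concat_pat21)

lemma occ_pat21_above:
  assumes "above \<sigma> \<rho>" "3 \<le> j"
  shows "occ (pat21 j) (\<sigma> @ \<rho>) = occ (pat21 j) \<sigma> + occ (pat21 j) \<rho>"
proof -
  have "hd (concat (pat21 j)) \<le> last (concat (pat21 j))"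
    using assms(2) by (simp add: concat_pat21)
  then show ?thesis
    using straddling_above_eq_empty[OF assms(1)] by (simp add: occ_append concat_pat21)
qed

lemma occ_21_snoc: "above [m] \<pi> \<Longrightarrow> occ (pat21 2) (\<pi> @ [m]) = occ (pat21 2) \<pi>"
  by (rule occ_snoc_not_greatest[where a = 2]) (simp_all add: pat21_2)

lemma occ_21_above:
  assumes "above \<sigma> \<rho>" "\<sigma> \<noteq> []" "\<rho> \<noteq> []"
  shows "occ (pat21 2) (\<sigma> @ \<rho>) = occ (pat21 2) \<sigma> + occ (pat21 2) \<rho> + 1"
  unfolding pat21_2 by (subst occ_append) (simp_all only: straddling_21[OF assms], simp_all)

definition weight :: "(nat \<Rightarrow> 'a::comm_semiring_1) \<Rightarrow> nat list \<Rightarrow> 'a" where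
  "weight x \<pi> = (\<Prod>j=2..length \<pi>. x j ^ occ (pat21 j) \<pi>)"

lemma weight_Nil [simp]: "weight x [] = 1"
  by (simp add: weight_def)

lemma weight_eq_prod_atMost:
  assumes "length \<pi> \<le> N"
  shows "weight x \<pi> = (\<Prod>j=2..N. x j ^ occ (pat21 j) \<pi>)"
  unfolding weight_def using assms
  by (intro prod.mono_neutral_left) (auto simp: occ_pat21_eq_0)

lemma weight_map_strict_mono: "strict_mono f \<Longrightarrow> weight x (map f \<pi>) = weight x \<pi>"
  by (simp add: weight_def occ_map_strict_mono)

definition fuse :: "(nat \<Rightarrow> 'a::times) \<Rightarrow> nat \<Rightarrow> 'a" where
  "fuse x j = x j * x (j + 1)"

lemma weight_snoc:
  assumes "above [m] \<pi>"
  shows "weight x (\<pi> @ [m]) = weight (fuse x) \<pi>"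
proof (cases "\<pi> = []")
  case False
  let ?n = "length \<pi>" and ?c = "\<lambda>j. occ (pat21 j) \<pi>"
  have n: "2 \<le> Suc ?n" using False by (simp add: Suc_le_eq)
  have "weight x (\<pi> @ [m]) = x 2 ^ ?c 2 * (\<Prod>j=2..?n. x (Suc j) ^ (?c (Suc j) + ?c j))"
  proof -
    have "weight x (\<pi> @ [m]) = (\<Prod>j=2..Suc ?n. x j ^ occ (pat21 j) (\<pi> @ [m]))"
      by (simp add: weight_def)
    also have "\<dots> = x 2 ^ ?c 2 * (\<Prod>j=2..?n. x (Suc j) ^ occ (pat21 (Suc j)) (\<pi> @ [m]))"
      unfolding prod.atLeast_Suc_atMost[OF n] prod.shift_bounds_cl_Suc_ivl
      by (simp add: occ_21_snoc[OF assms])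
    finally show ?thesis by (simp add: occ_pat21_snoc[OF assms])
  qed
  also have "\<dots> = (x 2 ^ ?c 2 * (\<Prod>j=2..?n. x (Suc j) ^ ?c (Suc j))) * (\<Prod>j=2..?n. x (Suc j) ^ ?c j)"
    by (simp add: power_add prod.distrib mult.assoc)
  also have "x 2 ^ ?c 2 * (\<Prod>j=2..?n. x (Suc j) ^ ?c (Suc j)) = (\<Prod>j=2..Suc ?n. x j ^ ?c j)"
    unfolding prod.atLeast_Suc_atMost[OF n] prod.shift_bounds_cl_Suc_ivl ..
  also have "\<dots> = weight x \<pi>"
    by (simp only: weight_eq_prod_atMost[of \<pi> "Suc ?n"] le_SucI order_refl)
  also have "weight x \<pi> * (\<Prod>j=2..?n. x (Suc j) ^ ?c j) = weight (fuse x) \<pi>"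
    by (simp add: weight_def fuse_def power_mult_distrib prod.distrib)
  finally show ?thesis .
qed (simp add: weight_def)

lemma weight_append_above:
  assumes "above \<sigma> \<rho>" "\<sigma> \<noteq> []" "\<rho> \<noteq> []"
  shows "weight x (\<sigma> @ \<rho>) = x 2 * weight x \<sigma> * weight x \<rho>"
proof -
  define N where "N = length (\<sigma> @ \<rho>)"
  have "2 \<le> N" using assms(2,3) by (cases \<sigma>; cases \<rho>) (auto simp: N_def)
  have "x j ^ occ (pat21 j) (\<sigma> @ \<rho>) =
      (if j = 2 then x 2 else 1) * x j ^ occ (pat21 j) \<sigma> * x j ^ occ (pat21 j) \<rho>"
    if "j \<in> {2..N}" for j
    using that occ_21_above[OF assms] occ_pat21_above[OF assms(1), of j]
    by (cases "j = 2") (simp_all add: power_add mult_ac)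
  then have "weight x (\<sigma> @ \<rho>) = (\<Prod>j=2..N.
      (if j = 2 then x 2 else 1) * x j ^ occ (pat21 j) \<sigma> * x j ^ occ (pat21 j) \<rho>)"
    unfolding weight_def N_def by (rule prod.cong[OF refl])
  also have "\<dots> = x 2 * weight x \<sigma> * weight x \<rho>"
    using \<open>2 \<le> N\<close> weight_eq_prod_atMost[of \<sigma> N x] weight_eq_prod_atMost[of \<rho> N x]
    by (simp add: prod.distrib N_def)
  finally show ?thesis .
qed

section \<open>Dumont permutations avoiding 1-3-2\<close>

abbreviation avoids132 :: "nat list \<Rightarrow> bool" where
  "avoids132 \<pi> \<equiv> avoids \<pi> [[1], [3], [2]]"

lemma avoids132_nth:
  assumes "avoids132 \<pi>" "i < j" "j < k" "k < length \<pi>" "\<pi> ! k < \<pi> ! j"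
  shows "\<pi> ! k \<le> \<pi> ! i"
proof (rule ccontr)
  assume "\<not> \<pi> ! k \<le> \<pi> ! i"
  then have "order_iso (map (nth \<pi>) [i, j, k]) (concat [[1], [3], [2::nat]])"
    using assms(5) by (auto simp: order_iso_def less_Suc_eq)
  then have "[i, j, k] \<in> occurrences [[1], [3], [2]] \<pi>"
    using assms(2-4) by (auto simp: mem_occurrences_iff upt_rec)
  then show False using assms(1) by (simp add: avoids_def)
qed

lemma avoids132_split_greatest_iff:
  assumes "above [m] \<sigma>" "above (\<sigma> @ [m]) \<rho>"
  shows "avoids132 (\<sigma> @ m # \<rho>) \<longleftrightarrow> avoids132 \<sigma> \<and> avoids132 \<rho>"
proof -
  have "occ [[1], [3], [2]] ((\<sigma> @ [m]) @ \<rho>) =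
      occ [[1], [3], [2]] (\<sigma> @ [m]) + occ [[1], [3], [2]] \<rho>"
    using straddling_above_eq_empty[OF assms(2), of "[[1], [3], [2]]"] by (subst occ_append) auto
  also have "occ [[1], [3], [2]] (\<sigma> @ [m]) = occ [[1], [3], [2]] \<sigma>"
    by (rule occ_snoc_not_greatest[where a = 3]) (use assms(1) in simp_all)
  finally show ?thesis by (simp add: avoids_iff_occ_eq_0)
qed

lemma avoids132_split_greatest_above:
  assumes "avoids132 (\<sigma> @ m # \<rho>)" "distinct (\<sigma> @ m # \<rho>)" "above [m] \<rho>"
  shows "above \<sigma> \<rho>"
  unfolding above_def
proof (intro ballI)
  fix a c assume a: "a \<in> set \<sigma>" and c: "c \<in> set \<rho>"
  let ?\<pi> = "\<sigma> @ m # \<rho>"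
  obtain i where i: "i < length \<sigma>" "?\<pi> ! i = a"
    using a by (auto simp: in_set_conv_nth nth_append)
  obtain k where k: "k < length \<rho>" "\<rho> ! k = c"
    using c by (auto simp: in_set_conv_nth)
  have "?\<pi> ! (length \<sigma> + Suc k) = c" "?\<pi> ! length \<sigma> = m" "c < m"
    using k c assms(3) by (simp_all add: nth_append above_def)
  then have "c \<le> a"
    using avoids132_nth[OF assms(1), of i "length \<sigma>" "length \<sigma> + Suc k"] i k by simp
  moreover have "c \<noteq> a" using assms(2) a c by auto
  ultimately show "c < a" by simp
qed

lemma dumont_Nil [simp]: "dumont []"
  by (simp add: dumont_def)

lemma dumont_singleton [simp]: "dumont [a] \<longleftrightarrow> odd a"
  by (simp add: dumont_def)

lemma dumont_Cons_Cons [simp]: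
  "dumont (a # b # \<pi>) \<longleftrightarrow> (if even a then b < a else a < b) \<and> dumont (b # \<pi>)"
  by (auto simp: dumont_def All_less_Suc2)

lemma dumont_split_greatest_iff:
  assumes "above [m] \<sigma>" "above [m] \<rho>"
  shows "dumont (\<sigma> @ m # \<rho>) \<longleftrightarrow> dumont \<sigma> \<and> dumont \<rho> \<and> (odd m \<longleftrightarrow> \<rho> = [])"
proof -
  have "dumont (\<sigma> @ m # \<rho>) \<longleftrightarrow> dumont \<sigma> \<and> dumont (m # \<rho>)"
    using assms(1) by (induction \<sigma> rule: induct_list012) (auto simp: above_def)
  moreover have "dumont (m # \<rho>) \<longleftrightarrow> dumont \<rho> \<and> (odd m \<longleftrightarrow> \<rho> = [])"
    using assms(2) by (cases \<rho>) (auto simp: above_def)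
  ultimately show ?thesis by simp
qed

lemma dumont_map_add_even:
  "even k \<Longrightarrow> dumont (map (\<lambda>y. y + k) \<pi>) \<longleftrightarrow> dumont \<pi>"
  by (induction \<pi> rule: induct_list012) auto

lemma dumont_even_not_least:
  assumes "dumont \<pi>" "a \<in> set \<pi>" "even a"
  shows "\<exists>b\<in>set \<pi>. b < a"
proof -
  obtain i where "i < length \<pi>" "\<pi> ! i = a" using assms(2) by (auto simp: in_set_conv_nth)
  then have "Suc i < length \<pi> \<and> \<pi> ! Suc i < a" using assms by (auto simp: dumont_def)
  then show ?thesis by auto
qed

definition perm_words :: "nat list set" where
  "perm_words = {\<pi>. set \<pi> = {1..length \<pi>}}"

lemma Nil_in_perm_words [simp]: "[] \<in> perm_words"
  by (simp add: perm_words_def)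

lemma distinct_perm_words: "\<pi> \<in> perm_words \<Longrightarrow> distinct \<pi>"
  by (simp add: perm_words_def card_distinct)

lemma mem_perm_words_iff: "\<pi> \<in> perm_words \<longleftrightarrow> (\<exists>n. \<pi> \<in> permutations_of_set {1..n})"
proof
  assume "\<pi> \<in> perm_words"
  then show "\<exists>n. \<pi> \<in> permutations_of_set {1..n}"
    using distinct_perm_words by (auto simp: perm_words_def permutations_of_set_def)
next
  assume "\<exists>n. \<pi> \<in> permutations_of_set {1..n}"
  then obtain n where n: "\<pi> \<in> permutations_of_set {1..n}" ..
  then have "length \<pi> = n" using length_finite_permutations_of_set[OF n] by simp
  then show "\<pi> \<in> perm_words" using n by (simp add: perm_words_def permutations_of_set_def)
qed

lemma size_finite_perm_words: "size_finite length perm_words"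
  unfolding size_finite_def
proof
  fix n
  have "{\<pi> \<in> perm_words. length \<pi> = n} \<subseteq> permutations_of_set {1..n}"
    using distinct_perm_words by (auto simp: perm_words_def permutations_of_set_def)
  then show "finite {\<pi> \<in> perm_words. length \<pi> = n}"
    by (rule finite_subset) simp
qed

lemma dumont_avoid_132_iff:
  "\<pi> \<in> dumont_avoid_132 \<longleftrightarrow> \<pi> \<in> perm_words \<and> dumont \<pi> \<and> avoids132 \<pi>"
  by (simp add: dumont_avoid_132_def mem_perm_words_iff)

lemma Nil_in_dumont_avoid_132 [simp]: "[] \<in> dumont_avoid_132"
  by (simp add: dumont_avoid_132_iff avoids_iff_occ_eq_0 occ_eq_0_if_shorter)

lemma dumont_map_add_perm_word_iff:
  assumes "\<pi> \<in> perm_words"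
  shows "dumont (map (\<lambda>y. y + k) \<pi>) \<longleftrightarrow> dumont \<pi> \<and> (\<pi> = [] \<or> even k)"
proof (cases "\<pi> = [] \<or> even k")
  case False
  then have "1 + k \<in> set (map (\<lambda>y. y + k) \<pi>)" "even (1 + k)"
    using assms by (auto simp: perm_words_def Suc_le_eq)
  moreover have "\<forall>b\<in>set (map (\<lambda>y. y + k) \<pi>). 1 + k \<le> b"
    using assms by (auto simp: perm_words_def)
  ultimately show ?thesis using False dumont_even_not_least by (meson not_le)
qed (auto simp: dumont_map_add_even)

definition join_greatest :: "nat list \<Rightarrow> nat list \<Rightarrow> nat list" where
  "join_greatest \<sigma> \<rho> =
     map (\<lambda>y. y + length \<rho>) \<sigma> @ Suc (length \<sigma> + length \<rho>) # \<rho>"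

lemma length_join_greatest [simp]: "length (join_greatest \<sigma> \<rho>) = Suc (length \<sigma> + length \<rho>)"
  by (simp add: join_greatest_def)

lemma join_greatest_neq_Nil [simp]: "join_greatest \<sigma> \<rho> \<noteq> []"
  by (simp add: join_greatest_def)

lemma join_greatest_above:
  assumes "\<sigma> \<in> perm_words" "\<rho> \<in> perm_words"
  defines "m \<equiv> Suc (length \<sigma> + length \<rho>)"
  shows "above [m] (map (\<lambda>y. y + length \<rho>) \<sigma>)" "above [m] \<rho>"
    "above (map (\<lambda>y. y + length \<rho>) \<sigma> @ [m]) \<rho>"
  using assms by (auto simp: above_def perm_words_def)

lemma join_greatest_in_perm_words:
  assumes "\<sigma> \<in> perm_words" "\<rho> \<in> perm_words"
  shows "join_greatest \<sigma> \<rho> \<in> perm_words"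
proof -
  let ?k = "length \<rho>" and ?n = "length \<sigma> + length \<rho>"
  have "set (join_greatest \<sigma> \<rho>) = {1 + ?k..?n} \<union> {Suc ?n} \<union> {1..?k}"
    using assms by (simp add: join_greatest_def perm_words_def)
  also have "\<dots> = {1..Suc ?n}" by auto
  finally show ?thesis by (simp add: perm_words_def)
qed

lemma join_greatest_inject:
  assumes "\<sigma> \<in> perm_words" "\<rho> \<in> perm_words" "\<sigma>' \<in> perm_words" "\<rho>' \<in> perm_words"
  shows "join_greatest \<sigma> \<rho> = join_greatest \<sigma>' \<rho>' \<longleftrightarrow> \<sigma> = \<sigma>' \<and> \<rho> = \<rho>'"
proof
  let ?m = "Suc (length \<sigma> + length \<rho>)" and ?f = "\<lambda>\<rho> :: nat list. map (\<lambda>y. y + length \<rho>)"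
  assume eq: "join_greatest \<sigma> \<rho> = join_greatest \<sigma>' \<rho>'"
  then have "?m = Suc (length \<sigma>' + length \<rho>')" by (metis length_join_greatest)
  then have "?f \<rho> \<sigma> @ ?m # \<rho> = ?f \<rho>' \<sigma>' @ ?m # \<rho>'"
    using eq by (simp add: join_greatest_def)
  moreover have "?m \<notin> set (?f \<rho> \<sigma>)" "?m \<notin> set \<rho>"
    using assms(1,2) by (auto simp: perm_words_def)
  ultimately have "?f \<rho> \<sigma> = ?f \<rho>' \<sigma>' \<and> \<rho> = \<rho>'"
    by (metis append_Cons_eq_iff)
  moreover have "inj (\<lambda>y. y + length \<rho>)" by (simp add: inj_def)
  ultimately show "\<sigma> = \<sigma>' \<and> \<rho> = \<rho>'"
    using inj_map_eq_map by metis
qed simp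

lemma downward_closed_eq_atLeastAtMost_card:
  assumes "finite A" "0 \<notin> A" "\<And>b c. b \<in> A \<Longrightarrow> c \<in> {1..b} \<Longrightarrow> c \<in> A"
  shows "A = {1..card A}"
proof (rule card_subset_eq)
  show "A \<subseteq> {1..card A}"
  proof
    fix b assume b: "b \<in> A"
    then have "{1..b} \<subseteq> A" using assms(3) by blast
    then have "b \<le> card A" using card_mono[OF assms(1), of "{1..b}"] by simp
    then show "b \<in> {1..card A}" using b assms(2) by (cases b) auto
  qed
qed simp_all

lemma above_partition_intervals:
  assumes "set \<sigma> \<union> set \<rho> = {1..n}" "above \<sigma> \<rho>" "distinct \<rho>"
  shows "set \<rho> = {1..length \<rho>}" "set \<sigma> = {1 + length \<rho>..n}"
proof -
  have "set \<rho> = {1..card (set \<rho>)}"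
  proof (rule downward_closed_eq_atLeastAtMost_card)
    show "0 \<notin> set \<rho>" using assms(1) by (metis UnI2 atLeastAtMost_iff not_one_le_zero)
    fix b c assume b: "b \<in> set \<rho>" and c: "c \<in> {1..b}"
    then have "b \<le> n" using assms(1) by (metis UnI2 atLeastAtMost_iff)
    then have "c \<in> set \<sigma> \<union> set \<rho>" using c by (simp add: assms(1))
    then show "c \<in> set \<rho>"
      using assms(2) b c by (metis UnE above_def atLeastAtMost_iff not_le)
  qed simp
  then show \<rho>: "set \<rho> = {1..length \<rho>}"
    using assms(3) by (simp add: distinct_card)
  have "set \<sigma> \<inter> set \<rho> = {}" using assms(2) by (auto simp: above_def)
  then have "set \<sigma> = {1..n} - set \<rho>" using assms(1) by blast
  also have "\<dots> = {1 + length \<rho>..n}" by (auto simp: \<rho>)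
  finally show "set \<sigma> = {1 + length \<rho>..n}" .
qed

lemma avoids132_perm_word_cases:
  assumes "\<pi> \<in> perm_words" "avoids132 \<pi>" "\<pi> \<noteq> []"
  obtains (join_greatest) \<sigma> \<rho>
  where "\<sigma> \<in> perm_words" "\<rho> \<in> perm_words" "\<pi> = join_greatest \<sigma> \<rho>"
proof -
  obtain n where n: "length \<pi> = Suc n" using assms(3) by (cases \<pi>) auto
  then have letters: "set \<pi> = {1..Suc n}" using assms(1) by (simp add: perm_words_def)
  then have "Suc n \<in> set \<pi>" by simp
  then obtain \<tau> \<rho> where split: "\<pi> = \<tau> @ Suc n # \<rho>" by (metis split_list)
  have distinct: "distinct (\<tau> @ Suc n # \<rho>)"
    using distinct_perm_words[OF assms(1)] by (simp only: split)
  have "set \<tau> \<union> set \<rho> = set \<pi> - {Suc n}" using distinct by (auto simp: split)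
  also have "\<dots> = {1..n}" by (auto simp: letters)
  finally have other_letters: "set \<tau> \<union> set \<rho> = {1..n}" .
  then have "\<forall>b\<in>set \<tau> \<union> set \<rho>. b < Suc n" by simp
  then have "above [Suc n] \<rho>" by (simp add: above_def)
  then have "above \<tau> \<rho>"
    using avoids132_split_greatest_above[OF _ distinct] assms(2) by (simp add: split)
  then have \<rho>: "set \<rho> = {1..length \<rho>}" and \<tau>: "set \<tau> = {1 + length \<rho>..n}"
    using above_partition_intervals[OF other_letters] distinct by simp_all
  have n_eq: "n = length \<tau> + length \<rho>" using n split by simp
  define \<sigma> where "\<sigma> = map (\<lambda>y. y - length \<rho>) \<tau>"
  have "\<tau> = map (\<lambda>y. y + length \<rho>) \<sigma>"
    using \<tau> by (auto simp: \<sigma>_def intro!: map_idI[symmetric])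
  then have "\<pi> = join_greatest \<sigma> \<rho>" by (simp add: join_greatest_def split n_eq \<sigma>_def)
  moreover have "set \<tau> = (\<lambda>y. y + length \<rho>) ` {1..length \<tau>}"
    by (simp add: \<tau> n_eq)
  then have "set \<sigma> = {1..length \<sigma>}"
    unfolding \<sigma>_def set_map length_map by (simp add: image_image del: image_add_atLeastAtMost')
  ultimately show thesis using that \<rho> by (simp add: perm_words_def)
qed

lemma join_greatest_in_dumont_avoid_132_iff:
  assumes "\<sigma> \<in> perm_words" "\<rho> \<in> perm_words"
  shows "join_greatest \<sigma> \<rho> \<in> dumont_avoid_132 \<longleftrightarrow>
    \<sigma> \<in> dumont_avoid_132 \<and> \<rho> \<in> dumont_avoid_132 \<and>
    (\<sigma> = [] \<or> even (length \<rho>)) \<and> (\<rho> = [] \<longleftrightarrow> even (length \<sigma> + length \<rho>))"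
proof -
  let ?\<sigma> = "map (\<lambda>y. y + length \<rho>) \<sigma>" and ?m = "Suc (length \<sigma> + length \<rho>)"
  note above = join_greatest_above[OF assms]
  have "dumont (join_greatest \<sigma> \<rho>) \<longleftrightarrow> dumont ?\<sigma> \<and> dumont \<rho> \<and> (odd ?m \<longleftrightarrow> \<rho> = [])"
    unfolding join_greatest_def by (rule dumont_split_greatest_iff[OF above(1,2)])
  moreover have "avoids132 (join_greatest \<sigma> \<rho>) \<longleftrightarrow> avoids132 ?\<sigma> \<and> avoids132 \<rho>"
    unfolding join_greatest_def by (rule avoids132_split_greatest_iff[OF above(1,3)])
  moreover have "avoids132 ?\<sigma> \<longleftrightarrow> avoids132 \<sigma>"
    by (simp add: avoids_iff_occ_eq_0 occ_map_strict_mono strict_mono_def)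
  ultimately show ?thesis
    using assms join_greatest_in_perm_words[OF assms]
    by (auto simp: dumont_avoid_132_iff dumont_map_add_perm_word_iff)
qed

lemma weight_join_greatest:
  assumes "\<sigma> \<in> perm_words" "\<rho> \<in> perm_words"
  shows "weight x (join_greatest \<sigma> \<rho>) =
    (if \<rho> = [] then 1 else x 2) * weight (fuse x) \<sigma> * weight x \<rho>"
proof -
  let ?\<sigma> = "map (\<lambda>y. y + length \<rho>) \<sigma>" and ?m = "Suc (length \<sigma> + length \<rho>)"
  note above = join_greatest_above[OF assms]
  have "weight x (?\<sigma> @ [?m]) = weight (fuse x) ?\<sigma>"
    by (rule weight_snoc[OF above(1)])
  also have "\<dots> = weight (fuse x) \<sigma>"
    by (simp add: weight_map_strict_mono strict_mono_def)
  finally have snoc: "weight x (?\<sigma> @ [?m]) = weight (fuse x) \<sigma>" .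
  show ?thesis
  proof (cases "\<rho> = []")
    case True
    then show ?thesis using snoc by (simp add: join_greatest_def)
  next
    case False
    then show ?thesis
      using snoc weight_append_above[OF above(3), of x] by (simp add: join_greatest_def)
  qed
qed

definition even_dumont132 :: "nat list set" where
  "even_dumont132 = {\<pi> \<in> dumont_avoid_132. even (length \<pi>)}"

definition odd_dumont132 :: "nat list set" where
  "odd_dumont132 = {\<pi> \<in> dumont_avoid_132. odd (length \<pi>)}"

lemma even_odd_dumont132_subset_perm_words:
  "even_dumont132 \<subseteq> perm_words" "odd_dumont132 \<subseteq> perm_words"
  by (auto simp: even_dumont132_def odd_dumont132_def dumont_avoid_132_iff)

lemma size_finite_dumont132:
  "size_finite length {[] :: nat list}" "size_finite length odd_dumont132"
  "size_finite length (even_dumont132 - {[]})"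
  by (rule size_finite_subset[OF size_finite_perm_words],
      use even_odd_dumont132_subset_perm_words in auto)+

lemma dumont_avoid_132_nonempty_cases:
  assumes "\<pi> \<in> dumont_avoid_132" "\<pi> \<noteq> []"
  obtains (join_greatest) \<sigma> \<rho> where "\<pi> = join_greatest \<sigma> \<rho>"
    "\<sigma> \<in> dumont_avoid_132" "\<rho> \<in> dumont_avoid_132"
    "\<sigma> = [] \<or> even (length \<rho>)" "\<rho> = [] \<longleftrightarrow> even (length \<sigma> + length \<rho>)"
proof -
  obtain \<sigma> \<rho> where "\<sigma> \<in> perm_words" "\<rho> \<in> perm_words" "\<pi> = join_greatest \<sigma> \<rho>"
    using assms by (auto simp: dumont_avoid_132_iff elim: avoids132_perm_word_cases)
  then show thesis using that assms join_greatest_in_dumont_avoid_132_iff by metis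
qed

lemma odd_dumont132_eq: "odd_dumont132 = (\<lambda>\<sigma>. join_greatest \<sigma> []) ` even_dumont132"
proof (intro equalityI subsetI)
  fix \<pi> assume "\<pi> \<in> odd_dumont132"
  then have \<pi>: "\<pi> \<in> dumont_avoid_132" "\<pi> \<noteq> []" "odd (length \<pi>)"
    by (auto simp: odd_dumont132_def)
  from \<pi>(1,2) show "\<pi> \<in> (\<lambda>\<sigma>. join_greatest \<sigma> []) ` even_dumont132"
  proof (cases rule: dumont_avoid_132_nonempty_cases)
    case (join_greatest \<sigma> \<rho>)
    then have "\<rho> = []" "\<sigma> \<in> even_dumont132"
      using \<pi>(3) by (auto simp: even_dumont132_def)
    then show ?thesis using join_greatest(1) by blast
  qed
qed (use even_odd_dumont132_subset_perm_words in
  \<open>auto simp: odd_dumont132_def even_dumont132_def join_greatest_in_dumont_avoid_132_iff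
    subset_iff\<close>)

definition even_dumont132_pairs :: "(nat list \<times> nat list) set" where
  "even_dumont132_pairs = {[]} \<times> odd_dumont132 \<union> odd_dumont132 \<times> (even_dumont132 - {[]})"

lemma even_dumont132_pairs_subset: "even_dumont132_pairs \<subseteq> perm_words \<times> (perm_words - {[]})"
  using even_odd_dumont132_subset_perm_words
  by (auto simp: even_dumont132_pairs_def odd_dumont132_def)

lemma even_dumont132_eq:
  "even_dumont132 - {[]} = (\<lambda>(\<sigma>, \<rho>). join_greatest \<sigma> \<rho>) ` even_dumont132_pairs"
proof (intro equalityI subsetI)
  fix \<pi> assume "\<pi> \<in> even_dumont132 - {[]}"
  then have \<pi>: "\<pi> \<in> dumont_avoid_132" "\<pi> \<noteq> []" "even (length \<pi>)" by (auto simp: even_dumont132_def)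
  from \<pi>(1,2) show "\<pi> \<in> (\<lambda>(\<sigma>, \<rho>). join_greatest \<sigma> \<rho>) ` even_dumont132_pairs"
  proof (cases rule: dumont_avoid_132_nonempty_cases)
    case (join_greatest \<sigma> \<rho>)
    then have "(\<sigma>, \<rho>) \<in> even_dumont132_pairs"
      using \<pi>(3) by (auto simp: even_dumont132_pairs_def even_dumont132_def odd_dumont132_def)
    then show ?thesis by (rule rev_image_eqI) (simp add: join_greatest(1))
  qed
qed (use even_odd_dumont132_subset_perm_words in
  \<open>auto simp: even_dumont132_pairs_def odd_dumont132_def even_dumont132_def
    join_greatest_in_dumont_avoid_132_iff subset_iff\<close>)

section \<open>The functional equations\<close>

lemma C_gf_eq_class_gf: "C_gf x = class_gf length (weight x) dumont_avoid_132"
  by (simp add: C_gf_def class_gf_def weight_def)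

lemma A3_eq_class_gf: "A3 x = class_gf length (weight x) even_dumont132"
  unfolding even_dumont132_def
  by (rule fps_ext)
    (simp add: class_gf_filter_size_nth[where P = even] A3_def fps_compose_uminus_fps_X_nth
      flip: C_gf_eq_class_gf)

lemma B3_eq_class_gf: "B3 x = class_gf length (weight x) odd_dumont132"
  unfolding odd_dumont132_def
  by (rule fps_ext)
    (simp add: class_gf_filter_size_nth[where P = odd] B3_def fps_compose_uminus_fps_X_nth
      flip: C_gf_eq_class_gf)

lemma A3_minus_1_eq_class_gf: "A3 x - 1 = class_gf length (weight x) (even_dumont132 - {[]})"
proof -
  have "even_dumont132 = {[]} \<union> (even_dumont132 - {[]})"
    by (auto simp: even_dumont132_def)
  also have "class_gf length (weight x) \<dots> =
      class_gf length (weight x) {[]} + class_gf length (weight x) (even_dumont132 - {[]})"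
    by (intro class_gf_Un size_finite_dumont132) auto
  finally show ?thesis by (simp add: A3_eq_class_gf class_gf_singleton)
qed

lemma B3_eq_fps_X_mult_A3: "B3 x = fps_X * A3 (fuse x)"
proof -
  have perm: "\<sigma> \<in> perm_words" if "\<sigma> \<in> even_dumont132" for \<sigma>
    using that even_odd_dumont132_subset_perm_words by auto
  have "B3 x = class_gf (\<lambda>\<sigma>. length (join_greatest \<sigma> [])) (\<lambda>\<sigma>. weight x (join_greatest \<sigma> []))
      even_dumont132"
    unfolding B3_eq_class_gf odd_dumont132_eq
    by (rule class_gf_image) (auto simp: inj_on_def join_greatest_inject perm)
  also have "\<dots> = class_gf (\<lambda>\<sigma>. Suc (length \<sigma>)) (weight (fuse x)) even_dumont132"
    by (rule class_gf_cong) (simp_all add: weight_join_greatest perm)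
  finally show ?thesis by (simp only: class_gf_Suc A3_eq_class_gf)
qed

lemma A3_minus_1_eq_class_gf_pairs:
  "A3 x - 1 = fps_X * fps_const (x 2) * class_gf (\<lambda>(\<sigma>, \<rho>). length \<sigma> + length \<rho>)
     (\<lambda>(\<sigma>, \<rho>). weight (fuse x) \<sigma> * weight x \<rho>) even_dumont132_pairs"
proof -
  let ?sz = "\<lambda>(\<sigma> :: nat list, \<rho> :: nat list). length \<sigma> + length \<rho>"
  let ?w = "\<lambda>(\<sigma>, \<rho>). weight (fuse x) \<sigma> * weight x \<rho>"
  let ?join = "\<lambda>(\<sigma>, \<rho>). join_greatest \<sigma> \<rho>"
  have "inj_on ?join (perm_words \<times> perm_words)"
    by (auto simp: inj_on_def join_greatest_inject)
  then have "inj_on ?join even_dumont132_pairs"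
    by (rule inj_on_subset) (use even_dumont132_pairs_subset in blast)
  then have "A3 x - 1 =
      class_gf (\<lambda>p. length (?join p)) (\<lambda>p. weight x (?join p)) even_dumont132_pairs"
    unfolding A3_minus_1_eq_class_gf even_dumont132_eq by (rule class_gf_image)
  also have "\<dots> = class_gf (\<lambda>p. Suc (?sz p)) (\<lambda>p. x 2 * ?w p) even_dumont132_pairs"
  proof (rule class_gf_cong)
    fix p assume "p \<in> even_dumont132_pairs"
    then obtain \<sigma> \<rho> where "p = (\<sigma>, \<rho>)" "\<sigma> \<in> perm_words" "\<rho> \<in> perm_words" "\<rho> \<noteq> []"
      using even_dumont132_pairs_subset by blast
    then show "length (?join p) = Suc (?sz p)" "weight x (?join p) = x 2 * ?w p"
      by (simp_all add: weight_join_greatest mult.assoc)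
  qed
  finally show ?thesis by (simp only: class_gf_Suc class_gf_mult_const mult.assoc)
qed

lemma A3_minus_1_eq:
  "A3 x - 1 = fps_X * fps_const (x 2) * (B3 x + B3 (fuse x) * (A3 x - 1))"
proof -
  let ?sz = "\<lambda>(\<sigma> :: nat list, \<rho> :: nat list). length \<sigma> + length \<rho>"
  let ?w = "\<lambda>(\<sigma>, \<rho>). weight (fuse x) \<sigma> * weight x \<rho>"
  note A3_minus_1_eq_class_gf_pairs
  also have "class_gf ?sz ?w even_dumont132_pairs = class_gf ?sz ?w ({[]} \<times> odd_dumont132) +
      class_gf ?sz ?w (odd_dumont132 \<times> (even_dumont132 - {[]}))"
    unfolding even_dumont132_pairs_def
    by (intro class_gf_Un size_finite_Times size_finite_dumont132)
      (auto simp: odd_dumont132_def)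
  also have "class_gf ?sz ?w ({[]} \<times> odd_dumont132) =
      class_gf length (weight (fuse x)) {[]} * B3 x"
    unfolding B3_eq_class_gf by (intro class_gf_Times size_finite_dumont132)
  also have "\<dots> = B3 x"
    by (simp add: class_gf_singleton)
  also have "class_gf ?sz ?w (odd_dumont132 \<times> (even_dumont132 - {[]})) =
      B3 (fuse x) * (A3 x - 1)"
    unfolding B3_eq_class_gf A3_minus_1_eq_class_gf
    by (intro class_gf_Times size_finite_dumont132)
  finally show ?thesis .
qed

theorem theorem2p14:
  fixes x :: "nat \<Rightarrow> 'a::field_char_0"
  shows "A3 x =
           1 + (fps_X ^ 2 * fps_const (x 2) * A3 (\<lambda>j. x j * x (j + 1))) /
               (1 - fps_X ^ 2 * fps_const (x 2) * A3 (\<lambda>j. x j * x (j + 1) ^ 2 * x (j + 2)))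
         \<and> B3 x = fps_X * A3 (\<lambda>j. x j * x (j + 1))"
proof -
  let ?N = "fps_X ^ 2 * fps_const (x 2) * A3 (fuse x)"
  let ?D = "1 - fps_X ^ 2 * fps_const (x 2) * A3 (fuse (fuse x))"
  have fuse: "(\<lambda>j. x j * x (j + 1)) = fuse x"
    "(\<lambda>j. x j * x (j + 1) ^ 2 * x (j + 2)) = fuse (fuse x)"
    by (auto simp: fuse_def power2_eq_square mult_ac)
  have "(A3 x - 1) * ?D = ?N"
    using A3_minus_1_eq[of x] by (simp add: B3_eq_fps_X_mult_A3 power2_eq_square algebra_simps)
  moreover have "?D $ 0 = 1" by simp
  then have "?D \<noteq> 0" by (metis fps_zero_nth zero_neq_one)
  ultimately have "A3 x - 1 = ?N / ?D" by (metis nonzero_mult_div_cancel_right)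
  then have "A3 x = 1 + ?N / ?D" by (simp add: algebra_simps)
  then show ?thesis unfolding fuse by (simp add: B3_eq_fps_X_mult_A3)
qed

end
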